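(* Let $d\ge1$ be the space dimension, let $\mu>0$ and $3\lambda+2\mu>0$ be constants, let $0<\theta<1$, and let $0<\frac{a}{2^d}<a<\frac{b}{2^d}<b$. Suppose the pressure function $p$ (smooth on $(0,\infty)$) satisfies $$p\Big(\frac{a}{t^d}\Big)=p\Big(\frac{b}{t^d}\Big)\quad\text{for all }t\in[1,2].$$ Then the pair $(\rho,u)$ defined for $t\in[1,2]$, $y\in\mathbb{R}^d$ by $$\rho(t,y)=\begin{cases}\dfrac{a}{t^d}, & kt<|y|<(k+\theta)t,\\[4pt] \dfrac{b}{t^d}, & (k+\theta)t<|y|<(k+1)t,\end{cases}\quad k\in\{0,1,2,\dots\},\qquad u(t,y)=\frac{y}{t},$$ is a weak solution on $[1,2]\times\mathbb{R}^d$ of the compressible Navier–Stokes system with (non-monotone) pressure $p$, $$\partial_t\rho+\operatorname{div}(\rho u)=0,\qquad \partial_t(\rho u)+\operatorname{div}(\rho u\otimes u)+\nabla p(\rho)=\operatorname{div}\Big(\mu(\nabla u+\nabla u^T)+\lambda(\operatorname{div}u)\,I\Big).$$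
   Context: A weak solution is a pair $(\rho,u)$ satisfying both equations in the sense of distributions on $(1,2)\times\mathbb{R}^d$. *)

theory Defs
  imports "HOL-Analysis.Analysis"
begin

definition dir_deriv :: "'a::euclidean_space \<Rightarrow> ('a \<Rightarrow> real) \<Rightarrow> 'a \<Rightarrow> real" where
  "dir_deriv e f x = frechet_derivative f (at x) e"

text \<open>\<open>Ck_on k S f\<close> is meant for open \<open>S\<close>: all partial derivatives of \<open>f\<close> up to order \<open>k\<close>
  exist and are continuous on \<open>S\<close>.\<close>

primrec Ck_on :: "nat \<Rightarrow> 'a::euclidean_space set \<Rightarrow> ('a \<Rightarrow> real) \<Rightarrow> bool" where
  "Ck_on 0 S f \<longleftrightarrow> continuous_on S f"
| "Ck_on (Suc k) S f \<longleftrightarrow>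
     (\<forall>x\<in>S. f differentiable (at x)) \<and> (\<forall>e\<in>Basis. Ck_on k S (dir_deriv e f))"

definition smooth_on :: "'a::euclidean_space set \<Rightarrow> ('a \<Rightarrow> real) \<Rightarrow> bool" where
  "smooth_on S f \<longleftrightarrow> (\<forall>k. Ck_on k S f)"

definition test_functions :: "'a::euclidean_space set \<Rightarrow> ('a \<Rightarrow> real) set" where
  "test_functions \<Omega> = {\<phi>. smooth_on UNIV \<phi> \<and>
     compact (closure {x. \<phi> x \<noteq> 0}) \<and> closure {x. \<phi> x \<noteq> 0} \<subseteq> \<Omega>}"

definition locally_integrable_on :: "('a::euclidean_space \<Rightarrow> real) \<Rightarrow> 'a set \<Rightarrow> bool"
    (infixr \<open>locally'_integrable'_on\<close> 46) where
  "f locally_integrable_on \<Omega> \<longleftrightarrow>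
     (\<forall>K. compact K \<and> K \<subseteq> \<Omega> \<longrightarrow> f absolutely_integrable_on K)"

text \<open>Distributions are represented by real functionals on functions; only their values on
  \<open>test_functions \<Omega>\<close> matter.\<close>

type_synonym 'a functional = "('a \<Rightarrow> real) \<Rightarrow> real"

definition distr_of :: "'a::euclidean_space set \<Rightarrow> ('a \<Rightarrow> real) \<Rightarrow> 'a functional" where
  "distr_of \<Omega> f \<phi> = (LINT x:\<Omega>|lebesgue. f x * \<phi> x)"

definition distr_deriv :: "'a::euclidean_space \<Rightarrow> 'a functional \<Rightarrow> 'a functional" where
  "distr_deriv e T \<phi> = - T (dir_deriv e \<phi>)"

text \<open>Space-time points are pairs \<open>(t, y)\<close>.\<close>

type_synonym 'n spacetime = "real \<times> (real ^ 'n)"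

abbreviation dt :: "('n::finite) spacetime functional \<Rightarrow> ('n::finite) spacetime functional" where
  "dt \<equiv> distr_deriv (1, 0)"

abbreviation dx :: "'n \<Rightarrow> ('n::finite) spacetime functional \<Rightarrow> ('n::finite) spacetime functional" where
  "dx i \<equiv> distr_deriv (0, axis i 1)"

text \<open>The \<open>(i,j)\<close> entry of \<open>\<mu> (\<nabla>u + \<nabla>u\<^sup>T) + lam (div u) I\<close>, with all derivatives of \<open>u\<close>
  distributional.\<close>

definition viscous_stress ::
  "('n::finite) spacetime set \<Rightarrow> real \<Rightarrow> real \<Rightarrow> ('n spacetime \<Rightarrow> real ^ 'n)
     \<Rightarrow> 'n \<Rightarrow> 'n \<Rightarrow> ('n::finite) spacetime functional" where
  "viscous_stress \<Omega> \<mu> lam u i j \<phi> =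
     \<mu> * (dx j (distr_of \<Omega> (\<lambda>z. u z $ i)) \<phi> + dx i (distr_of \<Omega> (\<lambda>z. u z $ j)) \<phi>)
     + lam * (if i = j then (\<Sum>k\<in>UNIV. dx k (distr_of \<Omega> (\<lambda>z. u z $ k)) \<phi>) else 0)"

text \<open>The integrability clauses make every term of the system a distribution on \<open>\<Omega>\<close> (an
  undefined Bochner integral is \<open>0\<close>); positivity of the density is needed for \<open>p (\<rho> z)\<close> to be
  meaningful, since the pressure is only given on \<open>(0,\<infinity>)\<close>.\<close>

definition weak_solution_NS ::
  "('n::finite) spacetime set \<Rightarrow> real \<Rightarrow> real \<Rightarrow> (real \<Rightarrow> real)
     \<Rightarrow> ('n spacetime \<Rightarrow> real) \<Rightarrow> ('n spacetime \<Rightarrow> real ^ 'n) \<Rightarrow> bool" where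
  "weak_solution_NS \<Omega> \<mu> lam p \<rho> u \<longleftrightarrow>
     (AE z in lebesgue. z \<in> \<Omega> \<longrightarrow> 0 < \<rho> z) \<and>
     \<rho> locally_integrable_on \<Omega> \<and>
     (\<lambda>z. p (\<rho> z)) locally_integrable_on \<Omega> \<and>
     (\<forall>i. (\<lambda>z. u z $ i) locally_integrable_on \<Omega>) \<and>
     (\<forall>i. (\<lambda>z. \<rho> z * u z $ i) locally_integrable_on \<Omega>) \<and>
     (\<forall>i j. (\<lambda>z. \<rho> z * u z $ i * u z $ j) locally_integrable_on \<Omega>) \<and>
     (\<forall>\<phi>\<in>test_functions \<Omega>.
        dt (distr_of \<Omega> \<rho>) \<phi> + (\<Sum>j\<in>UNIV. dx j (distr_of \<Omega> (\<lambda>z. \<rho> z * u z $ j)) \<phi>) = 0) \<and>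
     (\<forall>i. \<forall>\<phi>\<in>test_functions \<Omega>.
        dt (distr_of \<Omega> (\<lambda>z. \<rho> z * u z $ i)) \<phi>
        + (\<Sum>j\<in>UNIV. dx j (distr_of \<Omega> (\<lambda>z. \<rho> z * u z $ i * u z $ j)) \<phi>)
        + dx i (distr_of \<Omega> (\<lambda>z. p (\<rho> z))) \<phi>
        = (\<Sum>j\<in>UNIV. dx j (viscous_stress \<Omega> \<mu> lam u i j) \<phi>))"

end

theory Submission
  imports Defs
begin

text \<open>Almost everywhere \<open>\<rho> (t, y) = t\<^sup>-\<^sup>d g (y / t)\<close> with a bounded profile \<open>g\<close>, and \<open>u = y / t\<close> is
  the velocity of the dilations \<open>t \<mapsto> t x\<close>. For any measurable, locally bounded \<open>w\<close>, the
  substitution \<open>y = t x\<close> turns \<open>\<integral>\<integral> t\<^sup>-\<^sup>d w (y / t) (\<partial>\<^sub>t \<phi> + u \<bullet> \<nabla>\<phi>) dy dt\<close> into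
  \<open>\<integral> w x \<integral> d/dt \<phi> (t, t x) dt dx = 0\<close>; no jump conditions on the spheres are needed. Taking
  \<open>w = g\<close> gives the continuity equation and \<open>w = g x\<^sub>i\<close> the transport part of the momentum
  equation. The pressure depends on \<open>t\<close> alone, and the stress of a velocity that is linear in
  \<open>y\<close> is constant in space, so their spatial derivatives vanish.\<close>

section \<open>Test functions, their derivatives and supports\<close>

lemma test_function_continuous:
  assumes "\<phi> \<in> test_functions \<Omega>"
  shows "continuous_on UNIV \<phi>"
proof -
  have "Ck_on 0 UNIV \<phi>"
    using assms unfolding test_functions_def smooth_on_def by blast
  then show ?thesis by simp
qed

lemma test_function_differentiable:
  assumes "\<phi> \<in> test_functions \<Omega>"
  shows "\<phi> differentiable (at x)"
proof -
  have "Ck_on (Suc 0) UNIV \<phi>"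
    using assms unfolding test_functions_def smooth_on_def by blast
  then show ?thesis by simp
qed

lemma test_function_has_derivative:
  assumes "\<phi> \<in> test_functions \<Omega>"
  shows "(\<phi> has_derivative frechet_derivative \<phi> (at x)) (at x)"
  using test_function_differentiable[OF assms] by (simp add: frechet_derivative_works)

text \<open>Off its closed support \<phi> vanishes on a whole neighbourhood, so there it has the
  derivative of the constant 0.\<close>

lemma dir_deriv_eq_0:
  assumes "x \<notin> closure {x. \<phi> x \<noteq> 0}"
  shows "dir_deriv e \<phi> x = 0"
proof -
  let ?S = "closure {x. \<phi> x \<noteq> 0}"
  have "(\<phi> has_derivative (\<lambda>_. 0)) (at x)"
  proof (rule has_derivative_transform_within_open)
    show "((\<lambda>_. 0) has_derivative (\<lambda>_. 0)) (at x)" by simp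
    show "open (- ?S)" "x \<in> - ?S" using assms by auto
    show "\<And>y. y \<in> - ?S \<Longrightarrow> 0 = \<phi> y" using closure_subset[of "{x. \<phi> x \<noteq> 0}"] by auto
  qed
  then have "frechet_derivative \<phi> (at x) = (\<lambda>_. 0)"
    using frechet_derivative_at[of \<phi> "\<lambda>_. 0" x] by simp
  then show ?thesis by (simp add: dir_deriv_def)
qed

text \<open>One compact set is to serve for \<phi> and for its derivatives in every direction at
  once.\<close>

lemma test_function_support:
  assumes "\<phi> \<in> test_functions \<Omega>"
  obtains K where "compact K" "K \<subseteq> \<Omega>" "\<And>x. x \<notin> K \<Longrightarrow> \<phi> x = 0"
    "\<And>x e. x \<notin> K \<Longrightarrow> dir_deriv e \<phi> x = 0"
proof
  show "compact (closure {x. \<phi> x \<noteq> 0})" "closure {x. \<phi> x \<noteq> 0} \<subseteq> \<Omega>"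
    using assms by (auto simp: test_functions_def)
  show "\<phi> x = 0" "dir_deriv e \<phi> x = 0" if "x \<notin> closure {x. \<phi> x \<noteq> 0}" for x e
    using that closure_subset[of "{x. \<phi> x \<noteq> 0}"] by (auto simp: dir_deriv_eq_0)
qed

text \<open>The order of smoothness drops by one, which costs nothing when all orders are present;
  the support can only shrink, by \<open>dir_deriv_eq_0\<close>. The restriction to
  \<open>Basis\<close> comes from the recursion of \<open>Ck_on\<close>.\<close>

lemma test_function_dir_deriv:
  assumes \<phi>: "\<phi> \<in> test_functions \<Omega>" and e: "e \<in> Basis"
  shows "dir_deriv e \<phi> \<in> test_functions \<Omega>"
proof -
  let ?S = "closure {x. \<phi> x \<noteq> 0}"
  have sub: "closure {x. dir_deriv e \<phi> x \<noteq> 0} \<subseteq> ?S"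
    using dir_deriv_eq_0[of _ \<phi> e] by (intro closure_minimal) auto
  have "Ck_on k UNIV (dir_deriv e \<phi>)" for k
  proof -
    have "Ck_on (Suc k) UNIV \<phi>"
      using \<phi> unfolding test_functions_def smooth_on_def by blast
    then show ?thesis using e by simp
  qed
  moreover have "compact (closure {x. dir_deriv e \<phi> x \<noteq> 0})"
    using \<phi> sub compact_Int_closed[of ?S "closure {x. dir_deriv e \<phi> x \<noteq> 0}"]
    by (auto simp: test_functions_def Int_absorb1)
  ultimately show ?thesis
    using \<phi> sub unfolding test_functions_def smooth_on_def by blast
qed

section \<open>Integrability, and distributions given by almost everywhere equal functions\<close>

lemma integrable_compact_support:
  fixes f :: "'a::euclidean_space \<Rightarrow> real"
  assumes "f \<in> borel_measurable borel" "compact K"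
    and "\<And>x. x \<in> K \<Longrightarrow> \<bar>f x\<bar> \<le> C" "\<And>x. x \<notin> K \<Longrightarrow> f x = 0"
  shows "integrable lborel f"
  using assms emeasure_compact_finite[OF assms(2)]
  by (intro integrableI_bounded_set[where A = K and B = C])
     (auto simp: borel_compact)

text \<open>The majorant \<open>h\<close> need not be bounded on \<Omega>, but it is on the compact
  support of \<psi>. Domination is asked of \<open>G\<close> in place of continuity because the
  density jumps across spheres.\<close>

lemma integrable_dominated_times_test_function:
  fixes G h \<psi> :: "'a::euclidean_space \<Rightarrow> real"
  assumes G: "G \<in> borel_measurable borel" and h: "continuous_on \<Omega> h"
    and le: "\<And>x. x \<in> \<Omega> \<Longrightarrow> \<bar>G x\<bar> \<le> h x" and \<psi>: "\<psi> \<in> test_functions \<Omega>"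
  shows "integrable lborel (\<lambda>x. G x * \<psi> x)"
proof -
  obtain K where K: "compact K" "K \<subseteq> \<Omega>" "\<And>x. x \<notin> K \<Longrightarrow> \<psi> x = 0"
    by (rule test_function_support[OF \<psi>]) blast
  note cont = test_function_continuous[OF \<psi>]
  have "continuous_on K (\<lambda>x. h x * \<bar>\<psi> x\<bar>)"
    using h cont K by (intro continuous_intros) (auto intro: continuous_on_subset)
  then have "bounded ((\<lambda>x. h x * \<bar>\<psi> x\<bar>) ` K)"
    using K compact_continuous_image compact_imp_bounded by blast
  then obtain C where C: "\<And>x. x \<in> K \<Longrightarrow> \<bar>h x * \<bar>\<psi> x\<bar>\<bar> \<le> C"
    unfolding bounded_iff by auto
  show ?thesis
  proof (rule integrable_compact_support[OF _ K(1)])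
    show "(\<lambda>x. G x * \<psi> x) \<in> borel_measurable borel"
      by (rule borel_measurable_times[OF G borel_measurable_continuous_onI[OF cont]])
    show "\<bar>G x * \<psi> x\<bar> \<le> C" if "x \<in> K" for x
    proof -
      have "\<bar>G x * \<psi> x\<bar> \<le> h x * \<bar>\<psi> x\<bar>"
        using le[of x] that K(2) by (auto simp: abs_mult intro!: mult_right_mono)
      also have "\<dots> \<le> C" using C[OF that] by linarith
      finally show ?thesis .
    qed
  qed (use K in auto)
qed

text \<open>This passes from the Lebesgue integral over \<Omega>, with \<open>f\<close> known only
  almost everywhere, to a Borel integral over the whole space, where Fubini is available. Outside
  \<Omega> the factor \<psi> vanishes, whatever the values of \<open>G\<close>.\<close>

lemma distr_of_AE_eq:
  fixes f G :: "'a::euclidean_space \<Rightarrow> real"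
  assumes AE: "AE x in lborel. x \<in> \<Omega> \<longrightarrow> f x = G x"
    and G: "G \<in> borel_measurable borel" and \<psi>: "\<psi> \<in> test_functions \<Omega>"
  shows "distr_of \<Omega> f \<psi> = (\<integral>x. G x * \<psi> x \<partial>lborel)"
proof -
  obtain K where K: "compact K" "K \<subseteq> \<Omega>" "\<And>x. x \<notin> K \<Longrightarrow> \<psi> x = 0"
    by (rule test_function_support[OF \<psi>]) blast
  have m: "(\<lambda>x. G x * \<psi> x) \<in> borel_measurable lborel"
    using borel_measurable_times[OF G borel_measurable_continuous_onI[OF test_function_continuous[OF \<psi>]]]
    by simp
  have ae: "AE x in lebesgue. indicator \<Omega> x *\<^sub>R (f x * \<psi> x) = G x * \<psi> x"
    using AE_completion[OF AE] by eventually_elim (use K in \<open>auto simp: indicator_def\<close>)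
  have meas: "(\<lambda>x. G x * \<psi> x) \<in> borel_measurable lebesgue"
    using m by (rule measurable_completion)
  have "distr_of \<Omega> f \<psi> = (\<integral>x. indicator \<Omega> x *\<^sub>R (f x * \<psi> x) \<partial>lebesgue)"
    by (simp add: distr_of_def set_lebesgue_integral_def)
  also have "\<dots> = (\<integral>x. G x * \<psi> x \<partial>lebesgue)"
  proof (rule integral_cong_AE[OF _ meas ae])
    \<comment> \<open>\<open>f\<close> is not assumed measurable; the left integrand inherits
      measurability from the completeness of Lebesgue measure.\<close>
    have "AE x in lebesgue. G x * \<psi> x = indicator \<Omega> x *\<^sub>R (f x * \<psi> x)"
      using ae by eventually_elim (rule sym)
    with measurable_completion[OF m] show "(\<lambda>x. indicator \<Omega> x *\<^sub>R (f x * \<psi> x)) \<in> borel_measurable lebesgue"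
      by (rule borel_measurable_AE)
  qed
  also have "\<dots> = (\<integral>x. G x * \<psi> x \<partial>lborel)"
    by (rule integral_completion[OF m])
  finally show ?thesis .
qed

text \<open>Continuity of \<open>h\<close> bounds \<open>G\<close> on each compact subset of
  \<Omega>, and completeness of Lebesgue measure carries integrability over from \<open>G\<close> to
  \<open>f\<close>.\<close>

lemma locally_integrable_AE_eq:
  fixes f G h :: "'a::euclidean_space \<Rightarrow> real"
  assumes AE: "AE x in lborel. x \<in> \<Omega> \<longrightarrow> f x = G x"
    and G: "G \<in> borel_measurable borel" and h: "continuous_on \<Omega> h"
    and le: "\<And>x. x \<in> \<Omega> \<Longrightarrow> \<bar>G x\<bar> \<le> h x"
  shows "f locally_integrable_on \<Omega>"
  unfolding locally_integrable_on_def
proof (intro allI impI, elim conjE)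
  fix K assume K: "compact K" "K \<subseteq> \<Omega>"
  have "bounded (h ` K)"
    using K h compact_continuous_image compact_imp_bounded continuous_on_subset by metis
  then obtain C where C: "\<And>x. x \<in> K \<Longrightarrow> \<bar>h x\<bar> \<le> C"
    unfolding bounded_iff by auto
  have bK: "K \<in> sets borel" using K borel_compact by blast
  have int: "integrable lborel (\<lambda>x. indicator K x *\<^sub>R G x)"
  proof (rule integrable_compact_support[OF _ K(1)])
    show "\<bar>indicator K x *\<^sub>R G x\<bar> \<le> C" if "x \<in> K" for x
      using le[of x] C[of x] K that by force
  qed (use G bK in auto)
  have ae: "AE x in lebesgue. indicator K x *\<^sub>R G x = indicator K x *\<^sub>R f x"
    using AE_completion[OF AE] by eventually_elim (use K in \<open>auto simp: indicator_def\<close>)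
  have m: "(\<lambda>x. indicator K x *\<^sub>R G x) \<in> borel_measurable lborel"
    using int by auto
  have intl: "integrable lebesgue (\<lambda>x. indicator K x *\<^sub>R G x)"
    using int m by (simp add: integrable_completion)
  have "(\<lambda>x. indicator K x *\<^sub>R f x) \<in> borel_measurable lebesgue"
    using measurable_completion[OF m] ae by (rule borel_measurable_AE)
  then show "f absolutely_integrable_on K"
    unfolding set_integrable_def
    using integrable_cong_AE[THEN iffD1, OF _ _ ae intl] measurable_completion[OF m] by blast
qed

section \<open>Vanishing integrals of directional derivatives\<close>

lemma integrable_continuous_compact_support:
  fixes f :: "'a::euclidean_space \<Rightarrow> real"
  assumes "continuous_on UNIV f" "\<And>x. x \<notin> K \<Longrightarrow> f x = 0" "compact K"
  shows "integrable lborel f"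
proof -
  have "bounded (f ` K)"
    using assms compact_continuous_image compact_imp_bounded continuous_on_subset by (metis subset_UNIV)
  then obtain C where "\<And>x. x \<in> K \<Longrightarrow> \<bar>f x\<bar> \<le> C"
    unfolding bounded_iff by auto
  then show ?thesis
    using assms by (intro integrable_compact_support[of f K C] borel_measurable_continuous_onI)
qed

text \<open>By translation invariance, \<open>\<integral> \<partial>\<^sub>e h\<close> equals its average over the shifts \<open>s e\<close> with
  \<open>0 \<le> s \<le> 1\<close>, which by Fubini is \<open>\<integral> h (z + e) - h z dz = 0\<close>.\<close>

lemma integral_dir_deriv_eq_0:
  fixes h h' :: "'a::euclidean_space \<Rightarrow> real"
  assumes K: "compact K" "\<And>x. x \<notin> K \<Longrightarrow> h x = 0" "\<And>x. x \<notin> K \<Longrightarrow> h' x = 0"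
    and h': "continuous_on UNIV h'" and D: "\<And>x. (h has_derivative D x) (at x)"
    and De: "\<And>x. D x e = h' x"
  shows "(\<integral>x. h' x \<partial>lborel) = 0"
proof -
  have ch: "continuous_on UNIV h"
    using D by (meson differentiable_def differentiable_imp_continuous_on differentiable_on_def differentiable_at_withinI)
  have ih: "integrable lborel h"
    using integrable_continuous_compact_support ch K by blast
  have shift: "(\<integral>x. f (c + x) \<partial>lborel) = (\<integral>x. f x \<partial>lborel)"
    if "f \<in> borel_measurable borel" for f :: "'a \<Rightarrow> real" and c
  proof -
    have "(\<integral>x. f x \<partial>lborel) = (\<integral>x. f x \<partial>distr lborel borel ((+) c))"
      by (simp add: lborel_distr_plus)
    also have "\<dots> = (\<integral>x. f (c + x) \<partial>lborel)"
      using that by (subst integral_distr) auto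
    finally show ?thesis by simp
  qed
  define Q where "Q = (\<lambda>(s, z). indicator {0..1} s * h' (s *\<^sub>R e + z))"
  have mh': "h' \<in> borel_measurable borel" and mh: "h \<in> borel_measurable borel"
    using h' ch by (auto intro: borel_measurable_continuous_onI)
  have Qint: "integrable (lborel \<Otimes>\<^sub>M lborel) Q"
  proof -
    \<comment> \<open>\<open>L\<close> collects the points that some shift \<open>s e\<close> with 0
      \<le> s \<le> 1 carries into \<open>K\<close>, so \<open>Q\<close> vanishes off
      \<open>{0..1} \<times> L\<close>.\<close>
    define L where "L = (\<lambda>(s, z). z - s *\<^sub>R e) ` ({0..1::real} \<times> K)"
    have "compact ({0..1::real} \<times> K)" using K by (intro compact_Times) auto
    then have L: "compact L"
      unfolding L_def by (intro compact_continuous_image) (auto intro!: continuous_intros simp: split_beta)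
    have "bounded (h' ` K)"
      using K h' compact_continuous_image compact_imp_bounded continuous_on_subset by (metis subset_UNIV)
    then obtain C where C: "\<And>x. x \<in> K \<Longrightarrow> \<bar>h' x\<bar> \<le> C"
      unfolding bounded_iff by auto
    \<comment> \<open>The absolute value guards against an empty \<open>K\<close>, for which
      \<open>C\<close> may be negative.\<close>
    have C0: "\<bar>h' x\<bar> \<le> \<bar>C\<bar>" for x
      using C[of x] K(3)[of x] by (cases "x \<in> K") auto
    have "integrable lborel Q"
    proof (rule integrable_compact_support[where C = "\<bar>C\<bar>"])
      have [measurable]: "h' \<in> borel_measurable borel" by (rule mh')
      show "Q \<in> borel_measurable borel"
        unfolding Q_def borel_prod[symmetric] by measurable
      show "compact ({0..1::real} \<times> L)" using L by (intro compact_Times) auto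
      show "\<bar>Q x\<bar> \<le> \<bar>C\<bar>" for x
        using C0 by (auto simp: Q_def split_beta indicator_def)
      show "Q x = 0" if "x \<notin> {0..1} \<times> L" for x
      proof (cases x)
        case (Pair s z)
        have False if "s \<in> {0..1}" "s *\<^sub>R e + z \<in> K"
        proof -
          have "(\<lambda>(s, z). z - s *\<^sub>R e) (s, s *\<^sub>R e + z) \<in> L"
            unfolding L_def using that by (intro imageI) auto
          then show False using Pair \<open>x \<notin> _\<close> that by auto
        qed
        then show ?thesis using Pair K(3) by (auto simp: Q_def indicator_def)
      qed
    qed
    then show ?thesis by (simp add: lborel_prod)
  qed
  have FTC: "(\<integral>s. Q (s, z) \<partial>lborel) = h (e + z) - h z" for z
  proof -
    have "(\<integral>s. h' (s *\<^sub>R e + z) * indicator {0..1} s \<partial>lborel) = h (1 *\<^sub>R e + z) - h (0 *\<^sub>R e + z)"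
    proof (rule integral_FTC_Icc_real)
      fix s :: real
      have "((\<lambda>s. h (s *\<^sub>R e + z)) has_derivative (\<lambda>r. D (s *\<^sub>R e + z) (r *\<^sub>R e))) (at s)"
        by (rule has_derivative_compose[OF _ D, of "\<lambda>s. s *\<^sub>R e + z"]) (auto intro!: derivative_eq_intros)
      moreover have "D (s *\<^sub>R e + z) (r *\<^sub>R e) = r * h' (s *\<^sub>R e + z)" for r
        by (simp add: linear_cmul[OF has_derivative_linear[OF D]] De)
      ultimately show "((\<lambda>s. h (s *\<^sub>R e + z)) has_real_derivative h' (s *\<^sub>R e + z)) (at s)"
        by (simp add: has_real_derivative_iff_has_vector_derivative has_vector_derivative_def)
      have "continuous_on UNIV (\<lambda>s. h' (s *\<^sub>R e + z))"
        by (rule continuous_on_compose2[OF h']) (auto intro!: continuous_intros)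
      then show "isCont (\<lambda>s. h' (s *\<^sub>R e + z)) s"
        by (simp add: continuous_on_eq_continuous_at)
    qed simp
    then show ?thesis by (simp add: Q_def mult.commute)
  qed
  \<comment> \<open>The indicator has integral 1, so this inserts the average over the
    shifts.\<close>
  have "(\<integral>x. h' x \<partial>lborel) = (\<integral>s. indicator {0..1::real} s * (\<integral>x. h' x \<partial>lborel) \<partial>lborel)"
    by simp
  also have "\<dots> = (\<integral>s. (\<integral>z. Q (s, z) \<partial>lborel) \<partial>lborel)"
    by (rule Bochner_Integration.integral_cong) (simp_all add: Q_def shift[OF mh'])
  also have "\<dots> = (\<integral>z. (\<integral>s. Q (s, z) \<partial>lborel) \<partial>lborel)"
    using lborel_pair.Fubini_integral[of "\<lambda>s z. Q (s, z)"] Qint by simp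
  also have "\<dots> = (\<integral>z. h (e + z) - h z \<partial>lborel)"
    by (simp add: FTC)
  also have "\<dots> = 0"
  proof -
    have "integrable (distr lborel borel ((+) e)) h"
      using ih by (simp add: lborel_distr_plus)
    then have "integrable lborel (\<lambda>z. h (e + z))"
      using integrable_distr_eq[of "(+) e" lborel borel h] mh by simp
    then show ?thesis
      using ih shift[OF mh] by (subst Bochner_Integration.integral_diff) auto
  qed
  finally show ?thesis .
qed

section \<open>Integrals over time slices\<close>

lemma integral_slices_eq_0:
  fixes F :: "'a::euclidean_space \<times> 'b::euclidean_space \<Rightarrow> real"
  assumes "integrable lborel F" and "\<And>t. (\<integral>y. F (t, y) \<partial>lborel) = 0"
  shows "(\<integral>z. F z \<partial>lborel) = 0"
  using lborel_pair.integral_fst'[of F] assms by (simp add: lborel_prod)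

lemma axis_spatial_Basis:
  "((0::'a::euclidean_space), axis j (1::real)) \<in> Basis"
  by (auto simp: Basis_prod_def axis_in_Basis_iff)

lemma slice_has_derivative:
  assumes "\<psi> \<in> test_functions \<Omega>"
  shows "((\<lambda>y. \<psi> (t, y)) has_derivative (\<lambda>v. frechet_derivative \<psi> (at (t, y)) (0, v))) (at y)"
proof -
  have "((\<lambda>y. (t, y)) has_derivative (\<lambda>v. (0, v))) (at y)"
    by (intro has_derivative_Pair has_derivative_const has_derivative_ident)
  then show ?thesis
    using test_function_has_derivative[OF assms] by (rule has_derivative_compose)
qed

text \<open>Projecting the space-time support to space gives a compact set that works for all times
  at once.\<close>

lemma slice_support:
  fixes \<psi> :: "'a::euclidean_space \<times> 'b::euclidean_space \<Rightarrow> real"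
  assumes "\<psi> \<in> test_functions \<Omega>"
  obtains K where "compact K" "\<And>t y. y \<notin> K \<Longrightarrow> \<psi> (t, y) = 0"
    "\<And>t y e. y \<notin> K \<Longrightarrow> dir_deriv e \<psi> (t, y) = 0"
proof -
  obtain K where K: "compact K" "\<And>x. x \<notin> K \<Longrightarrow> \<psi> x = 0" "\<And>x e. x \<notin> K \<Longrightarrow> dir_deriv e \<psi> x = 0"
    by (rule test_function_support[OF assms]) blast
  show thesis
  proof (rule that)
    show "compact (snd ` K)"
      using K(1) by (intro compact_continuous_image) (auto intro: continuous_intros)
    fix t y e
    assume "y \<notin> snd ` K"
    then have "(t, y) \<notin> K"
      by (metis image_eqI snd_conv)
    then show "\<psi> (t, y) = 0" "dir_deriv e \<psi> (t, y) = 0"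
      using K(2,3) by auto
  qed
qed

lemma continuous_on_slice:
  assumes "continuous_on UNIV f"
  shows "continuous_on UNIV (\<lambda>y. f (t, y))"
  by (rule continuous_on_compose2[OF assms]) (auto intro!: continuous_intros)

lemma integral_slice_spatial_deriv:
  fixes \<psi> :: "('d::finite) spacetime \<Rightarrow> real"
  assumes \<psi>: "\<psi> \<in> test_functions \<Omega>"
  shows "(\<integral>y. dir_deriv (0, axis j 1) \<psi> (t, y) \<partial>lborel) = 0"
proof -
  let ?\<psi>' = "dir_deriv (0, axis j 1) \<psi>"
  obtain K where K: "compact K" "\<And>t y. y \<notin> K \<Longrightarrow> \<psi> (t, y) = 0"
      "\<And>t y e. y \<notin> K \<Longrightarrow> dir_deriv e \<psi> (t, y) = 0"
    by (rule slice_support[OF \<psi>]) blast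
  show ?thesis
  proof (rule integral_dir_deriv_eq_0[OF K(1)])
    show "((\<lambda>y. \<psi> (t, y)) has_derivative (\<lambda>v. frechet_derivative \<psi> (at (t, y)) (0, v))) (at y)" for y
      by (rule slice_has_derivative[OF \<psi>])
    show "continuous_on UNIV (\<lambda>y. ?\<psi>' (t, y))"
      by (rule continuous_on_slice[OF test_function_continuous[OF
            test_function_dir_deriv[OF \<psi> axis_spatial_Basis]]])
  qed (simp_all add: K, simp add: dir_deriv_def)
qed

text \<open>Integration by parts: \<partial>_j (y_i \<psi>) = y_i \<partial>_j \<psi> + \<delta>_ij
  \<psi>, and the last term integrates to 0 by \<open>int0\<close>. In the application \<psi> is
  itself a spatial derivative, which supplies \<open>int0\<close>.\<close>

lemma integral_slice_coord_spatial_deriv: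
  fixes \<psi> :: "('d::finite) spacetime \<Rightarrow> real"
  assumes \<psi>: "\<psi> \<in> test_functions \<Omega>" and int0: "(\<integral>y. \<psi> (t, y) \<partial>lborel) = 0"
  shows "(\<integral>y. y $ i * dir_deriv (0, axis j 1) \<psi> (t, y) \<partial>lborel) = 0"
proof -
  let ?\<psi>' = "dir_deriv (0, axis j 1) \<psi>"
  obtain K where K: "compact K" "\<And>t y. y \<notin> K \<Longrightarrow> \<psi> (t, y) = 0"
      "\<And>t y e. y \<notin> K \<Longrightarrow> dir_deriv e \<psi> (t, y) = 0"
    by (rule slice_support[OF \<psi>]) blast
  have c: "continuous_on UNIV (\<lambda>y. \<psi> (t, y))" and c': "continuous_on UNIV (\<lambda>y. ?\<psi>' (t, y))"
    by (rule continuous_on_slice[OF test_function_continuous[OF \<psi>]],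
        rule continuous_on_slice[OF test_function_continuous[OF
          test_function_dir_deriv[OF \<psi> axis_spatial_Basis]]])
  have int: "integrable lborel f"
    if "continuous_on UNIV f" "\<And>x. x \<notin> K \<Longrightarrow> f x = 0" for f :: "real ^ 'd \<Rightarrow> real"
    using that K(1) by (rule integrable_continuous_compact_support)
  define \<delta> :: real where "\<delta> = axis j 1 $ i"
  have "(\<integral>y. y $ i * ?\<psi>' (t, y) + \<delta> * \<psi> (t, y) \<partial>lborel) = 0"
  proof (rule integral_dir_deriv_eq_0[OF K(1), of "\<lambda>y. y $ i * \<psi> (t, y)"])
    show "((\<lambda>y. y $ i * \<psi> (t, y)) has_derivative
        (\<lambda>v. y $ i * frechet_derivative \<psi> (at (t, y)) (0, v) + v $ i * \<psi> (t, y))) (at y)" for y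
      by (rule has_derivative_mult[OF _ slice_has_derivative[OF \<psi>]])
         (auto intro!: bounded_linear_imp_has_derivative bounded_linear_vec_nth)
    show "continuous_on UNIV (\<lambda>y. y $ i * ?\<psi>' (t, y) + \<delta> * \<psi> (t, y))"
      using c c' by (intro continuous_intros)
  qed (simp_all add: K \<delta>_def, simp add: dir_deriv_def)
  moreover have "(\<integral>y. y $ i * ?\<psi>' (t, y) + \<delta> * \<psi> (t, y) \<partial>lborel)
      = (\<integral>y. y $ i * ?\<psi>' (t, y) \<partial>lborel) + (\<integral>y. \<delta> * \<psi> (t, y) \<partial>lborel)"
    using c c' K by (intro Bochner_Integration.integral_add int continuous_intros) auto
  ultimately show ?thesis
    using int0 by simp
qed

section \<open>Self-similar fields and their transport by dilations\<close>

lemma integral_scale_lborel: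
  fixes f :: "'a::euclidean_space \<Rightarrow> real"
  assumes "c > 0" and f: "f \<in> borel_measurable borel"
  shows "(\<integral>y. f y \<partial>lborel) = (\<integral>x. c ^ DIM('a) * f (c *\<^sub>R x) \<partial>lborel)"
proof -
  have "(\<integral>y. f y \<partial>lborel)
      = (\<integral>y. f y \<partial>density (distr lborel borel (\<lambda>x. 0 + c *\<^sub>R x)) (\<lambda>_. \<bar>c\<bar> ^ DIM('a)))"
    using assms by (subst lborel_affine[of c 0]) auto
  also have "\<dots> = (\<integral>y. \<bar>c\<bar> ^ DIM('a) * f y \<partial>distr lborel borel (\<lambda>x. 0 + c *\<^sub>R x))"
    using f by (subst integral_density) auto
  also have "\<dots> = (\<integral>x. c ^ DIM('a) * f (c *\<^sub>R x) \<partial>lborel)"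
    using assms by (subst integral_distr) auto
  finally show ?thesis .
qed

text \<open>The density with profile \<open>w\<close> carried along by the dilations: the power of t
  is the inverse Jacobian, so mass is conserved. Products with u have the same form, since y / t is
  constant along each path.\<close>

definition self_similar :: "(real ^ 'd \<Rightarrow> real) \<Rightarrow> ('d::finite) spacetime \<Rightarrow> real" where
  "self_similar w z = w ((1 / fst z) *\<^sub>R snd z) / fst z ^ CARD('d)"

lemma self_similar_measurable:
  assumes [measurable]: "w \<in> borel_measurable borel"
  shows "self_similar w \<in> borel_measurable borel"
  unfolding self_similar_def borel_prod[symmetric] by measurable

text \<open>\<open>w\<close> may jump, so it is dominated by a continuous \<open>v\<close> rescaled
  in the same way; the strip keeps t away from 0, where the rescaling is singular.\<close>

lemma self_similar_dominated:
  fixes w v :: "real ^ ('d::finite) \<Rightarrow> real"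
  assumes "continuous_on UNIV v" "\<And>x. \<bar>w x\<bar> \<le> v x"
  shows "continuous_on ({1<..<2} \<times> UNIV) (self_similar v)"
    and "z \<in> {1<..<2} \<times> UNIV \<Longrightarrow> \<bar>self_similar w z\<bar> \<le> self_similar v z"
proof -
  have "continuous_on ({1<..<2} \<times> UNIV) (\<lambda>z::'d spacetime. v ((1 / fst z) *\<^sub>R snd z))"
    by (rule continuous_on_compose2[OF assms(1)]) (auto intro!: continuous_intros)
  then show "continuous_on ({1<..<2} \<times> UNIV) (self_similar v)"
    unfolding self_similar_def by (intro continuous_intros) auto
  show "\<bar>self_similar w z\<bar> \<le> self_similar v z" if "z \<in> {1<..<2} \<times> UNIV"
    using that assms(2) by (auto simp: self_similar_def abs_divide power_abs intro!: divide_right_mono)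
qed

text \<open>The flux has profile \<open>w x * x $ j\<close> because u_j = x_j at y = t x. The
  profile stays general, with a continuous majorant, so that one lemma serves the density and every
  momentum component.\<close>

lemma self_similar_transport:
  fixes w v :: "real ^ ('d::finite) \<Rightarrow> real"
  assumes w: "w \<in> borel_measurable borel" and v: "continuous_on UNIV v"
    and wv: "\<And>x. \<bar>w x\<bar> \<le> v x"
    and \<phi>: "\<phi> \<in> test_functions ({1<..<2} \<times> UNIV)"
  shows "(\<integral>z. self_similar w z * dir_deriv (1, 0) \<phi> z \<partial>lborel)
    + (\<Sum>j\<in>UNIV. \<integral>z. self_similar (\<lambda>x. w x * x $ j) z * dir_deriv (0, axis j 1) \<phi> z \<partial>lborel) = 0"
proof -
  let ?\<Omega> = "{1<..<2::real} \<times> (UNIV :: (real ^ 'd) set)"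
  let ?t = "dir_deriv (1, 0) \<phi>" and ?x = "\<lambda>j. dir_deriv (0, axis j 1) \<phi>"
  have tB: "(1::real, 0::real ^ 'd) \<in> Basis" by (simp add: Basis_prod_def)
  have tt: "?t \<in> test_functions ?\<Omega>" and tx: "?x j \<in> test_functions ?\<Omega>" for j
    using test_function_dir_deriv[OF \<phi>] tB axis_spatial_Basis by blast+
  have ct: "continuous_on UNIV ?t" and cx: "continuous_on UNIV (?x j)" for j
    using test_function_continuous tt tx by blast+
  have wx: "(\<lambda>x. w x * x $ j) \<in> borel_measurable borel" for j
    using w by measurable
  have vx: "continuous_on UNIV (\<lambda>x. v x * \<bar>x $ j\<bar>)" for j
    using v by (intro continuous_intros)
  have wvx: "\<bar>w x * x $ j\<bar> \<le> v x * \<bar>x $ j\<bar>" for x j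
    using wv by (simp add: abs_mult mult_right_mono)
  have it: "integrable lborel (\<lambda>z. self_similar w z * ?t z)"
    by (rule integrable_dominated_times_test_function[OF self_similar_measurable[OF w]
          self_similar_dominated[OF v wv] tt])
  have ix: "integrable lborel (\<lambda>z. self_similar (\<lambda>x. w x * x $ j) z * ?x j z)" for j
    by (rule integrable_dominated_times_test_function[OF self_similar_measurable[OF wx]
          self_similar_dominated[OF vx wvx] tx])
  define F where "F z = self_similar w z * ?t z + (\<Sum>j\<in>UNIV. self_similar (\<lambda>x. w x * x $ j) z * ?x j z)" for z
  have iF: "integrable lborel F"
    unfolding F_def using it ix by auto
  have F_sum: "(\<integral>z. F z \<partial>lborel) = (\<integral>z. self_similar w z * ?t z \<partial>lborel)
    + (\<Sum>j\<in>UNIV. \<integral>z. self_similar (\<lambda>x. w x * x $ j) z * ?x j z \<partial>lborel)"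
    unfolding F_def using it ix by simp
  \<comment> \<open>\<open>E (t, x)\<close> is the derivative of \<phi> (t, t x) in t: the path has
    velocity (1, x).\<close>
  define E where "E = (\<lambda>(t, x). ?t (t, t *\<^sub>R x) + (\<Sum>j\<in>UNIV. x $ j * ?x j (t, t *\<^sub>R x)))"
  obtain K where K: "K \<subseteq> ?\<Omega>" "\<And>z. z \<notin> K \<Longrightarrow> \<phi> z = 0"
      "\<And>z e. z \<notin> K \<Longrightarrow> dir_deriv e \<phi> z = 0"
    by (rule test_function_support[OF \<phi>]) blast
  have off: "\<phi> z = 0" "?t z = 0" "?x j z = 0" if "z \<notin> ?\<Omega>" for z j
    using that K by blast+
  \<comment> \<open>Under y = t x the Jacobian t^d cancels the factor t^(-d) of the self-similar
    fields. For t outside (1,2), including t \<le> 0 where \<open>integral_scale_lborel\<close> does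
    not apply, both sides vanish with the derivatives of \<phi>.\<close>
  have scale: "(\<integral>y. F (t, y) \<partial>lborel) = (\<integral>x. w x * E (t, x) \<partial>lborel)" for t
  proof (cases "t \<in> {1<..<2}")
    case True
    have "F \<in> borel_measurable (lborel \<Otimes>\<^sub>M lborel)"
      using iF by (simp add: lborel_prod)
    then have m: "(\<lambda>y. F (t, y)) \<in> borel_measurable borel"
      by measurable
    have "(\<integral>y. F (t, y) \<partial>lborel) = (\<integral>x. t ^ CARD('d) * F (t, t *\<^sub>R x) \<partial>lborel)"
      using integral_scale_lborel[OF _ m, of t] True by simp
    also have "\<dots> = (\<integral>x. w x * E (t, x) \<partial>lborel)"
      using True by (intro Bochner_Integration.integral_cong)
        (auto simp: F_def E_def self_similar_def sum_distrib_left sum_distrib_right field_simps)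
    finally show ?thesis .
  next
    case False
    then show ?thesis by (simp add: F_def E_def off)
  qed
  have cE: "continuous_on UNIV E"
    unfolding E_def split_beta
    by (intro continuous_intros continuous_on_compose2[OF ct] continuous_on_compose2[OF cx]) auto
  have iQ: "integrable (lborel \<Otimes>\<^sub>M lborel) (\<lambda>(t, x). w x * E (t, x))"
  proof -
    obtain K where K: "compact K" "\<And>t y e. y \<notin> K \<Longrightarrow> dir_deriv e \<phi> (t, y) = 0"
      by (rule slice_support[OF \<phi>]) blast
    obtain R where R: "\<And>y. y \<in> K \<Longrightarrow> norm y \<le> R"
      using compact_imp_bounded[OF K(1)] unfolding bounded_iff by auto
    \<comment> \<open>\<open>R\<close> bounds the support in y = t x. As t > 1 on the strip, norm x
      > R forces norm (t x) > R, so the same radius bounds the support in x.\<close>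
    let ?L = "{1..2::real} \<times> cball (0 :: real ^ 'd) R"
    have L: "compact ?L" by (intro compact_Times) auto
    have "continuous_on UNIV (\<lambda>z. v (snd z) * \<bar>E z\<bar>)"
      by (intro continuous_intros cE continuous_on_compose2[OF v]) auto
    then have "bounded ((\<lambda>z. v (snd z) * \<bar>E z\<bar>) ` ?L)"
      using L by (meson compact_continuous_image compact_imp_bounded continuous_on_subset subset_UNIV)
    then obtain C where C: "\<And>z. z \<in> ?L \<Longrightarrow> \<bar>v (snd z) * \<bar>E z\<bar>\<bar> \<le> C"
      unfolding bounded_iff ball_simps real_norm_def by blast
    have "integrable lborel (\<lambda>z. w (snd z) * E z)"
    proof (rule integrable_compact_support[OF _ L])
      have [measurable]: "E \<in> borel_measurable (borel \<Otimes>\<^sub>M borel)"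
        unfolding borel_prod by (rule borel_measurable_continuous_onI[OF cE])
      show "(\<lambda>z. w (snd z) * E z) \<in> borel_measurable borel"
        using w unfolding borel_prod[symmetric] by measurable
      show "\<bar>w (snd z) * E z\<bar> \<le> C" if "z \<in> ?L" for z
      proof -
        have "\<bar>w (snd z) * E z\<bar> \<le> v (snd z) * \<bar>E z\<bar>"
          using wv by (simp add: abs_mult mult_right_mono)
        also have "\<dots> \<le> C" using C[OF that] by linarith
        finally show ?thesis .
      qed
      show "w (snd z) * E z = 0" if z: "z \<notin> ?L" for z
      proof (cases z)
        case (Pair t x)
        show ?thesis
        proof (cases "t \<in> {1<..<2}")
          case True
          then have "R < norm x" using z Pair by auto
          also have "\<dots> \<le> norm (t *\<^sub>R x)" using True by (simp add: mult_le_cancel_right1)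
          finally have "t *\<^sub>R x \<notin> K" using R by fastforce
          then show ?thesis using Pair by (simp add: E_def K)
        qed (simp add: Pair E_def off)
      qed
    qed
    then show ?thesis by (simp add: lborel_prod case_prod_unfold)
  qed
  have FTC: "(\<integral>t. E (t, x) \<partial>lborel) = 0" for x
  proof -
    \<comment> \<open>Both end values will vanish because the support of \<phi> lies in the open
      strip 1 < t < 2.\<close>
    have "(\<integral>t. E (t, x) * indicator {1..2} t \<partial>lborel) = \<phi> (2, 2 *\<^sub>R x) - \<phi> (1, 1 *\<^sub>R x)"
    proof (rule integral_FTC_Icc_real)
      fix t :: real
      let ?D = "frechet_derivative \<phi> (at (t, t *\<^sub>R x))"
      have D: "(\<phi> has_derivative ?D) (at (t, t *\<^sub>R x))"
        by (rule test_function_has_derivative[OF \<phi>])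
      have lin: "linear ?D" by (rule has_derivative_linear[OF D])
      have "?D (s, s *\<^sub>R x) = s * E (t, x)" for s
      proof -
        \<comment> \<open>Expanding the direction (1, x) in the basis makes linearity produce
          exactly the partial derivatives in \<open>E\<close>.\<close>
        have "(s, s *\<^sub>R x) = s *\<^sub>R ((1, 0) + (\<Sum>j\<in>UNIV. x $ j *\<^sub>R (0, axis j 1)))"
          by (simp add: prod_eq_iff fst_sum snd_sum basis_expansion scalar_mult_eq_scaleR[symmetric])
        then have "?D (s, s *\<^sub>R x) = s * (?D (1, 0) + (\<Sum>j\<in>UNIV. x $ j * ?D (0, axis j 1)))"
          by (simp only: linear_cmul[OF lin] linear_add[OF lin] linear_sum[OF lin] real_scaleR_def)
        then show ?thesis
          by (simp add: E_def dir_deriv_def)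
      qed
      moreover have "((\<lambda>t. (t, t *\<^sub>R x)) has_derivative (\<lambda>s. (s, s *\<^sub>R x))) (at t)"
        by (auto intro!: derivative_eq_intros)
      then have "((\<lambda>t. \<phi> (t, t *\<^sub>R x)) has_derivative (\<lambda>s. ?D (s, s *\<^sub>R x))) (at t)"
        using D by (rule has_derivative_compose)
      ultimately show "((\<lambda>t. \<phi> (t, t *\<^sub>R x)) has_real_derivative E (t, x)) (at t)"
        by (simp add: has_real_derivative_iff_has_vector_derivative has_vector_derivative_def)
      have "continuous_on UNIV (\<lambda>t. E (t, x))"
        by (rule continuous_on_compose2[OF cE]) (auto intro!: continuous_intros)
      then show "isCont (\<lambda>t. E (t, x)) t"
        by (simp add: continuous_on_eq_continuous_at)
    qed simp
    \<comment> \<open>Since \<open>E\<close> vanishes off the strip, the integral over [1,2] is the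
      integral over all t.\<close>
    moreover have "E (t, x) = 0" if "t \<notin> {1<..<2}" for t
      using that by (simp add: E_def off)
    then have "E (t, x) * indicator {1..2} t = E (t, x)" for t
      by (cases "t \<in> {1<..<2}") (simp_all add: indicator_def)
    ultimately show ?thesis by (simp add: off)
  qed
  have "(\<integral>z. F z \<partial>lborel) = (\<integral>t. (\<integral>y. F (t, y) \<partial>lborel) \<partial>lborel)"
    using lborel_pair.integral_fst'[of F] iF by (simp add: lborel_prod)
  also have "\<dots> = (\<integral>t. (\<integral>x. w x * E (t, x) \<partial>lborel) \<partial>lborel)"
    by (simp add: scale)
  \<comment> \<open>After the exchange \<open>w x\<close> is constant in the inner integral, so
    jumps of \<open>w\<close> do no harm.\<close>
  also have "\<dots> = (\<integral>x. (\<integral>t. w x * E (t, x) \<partial>lborel) \<partial>lborel)"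
    using lborel_pair.Fubini_integral[OF iQ] by simp
  also have "\<dots> = 0"
    by (simp add: FTC)
  finally show ?thesis
    using F_sum by simp
qed

section \<open>The striped density profile\<close>

lemma AE_norm_neq:
  fixes c :: "nat \<Rightarrow> real"
  shows "AE z in (lborel :: ('d::finite) spacetime measure). \<forall>k. norm (snd z) \<noteq> c k * fst z"
proof -
  have "AE z in lborel \<Otimes>\<^sub>M lborel. \<forall>k. norm (snd z :: real ^ 'd) \<noteq> c k * fst z"
  proof (rule lborel_pair.AE_pair_measure)
    show "AE t in lborel. AE y in lborel. \<forall>k. norm (snd (t, y :: real ^ 'd)) \<noteq> c k * fst (t, y)"
    \<comment> \<open>For fixed t and k the exceptional y form a sphere, which is null; countably
      many k keep the union null.\<close>
    proof (rule AE_I2, unfold AE_all_countable, rule allI)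
      fix t k
      have "sphere (0 :: real ^ 'd) (c k * t) \<in> null_sets lborel"
        using negligible_sphere[of "0 :: real ^ 'd" "c k * t"]
        by (simp add: negligible_iff_null_sets null_sets_completion_iff borel_closed)
      then show "AE y :: real ^ 'd in lborel. norm (snd (t, y)) \<noteq> c k * fst (t, y)"
        by (rule AE_I') auto
    qed
  qed measurable
  then show ?thesis unfolding lborel_prod .
qed

text \<open>In the variable x = y / t the moving shells stand still. For \<theta> < 1, k \<le> norm
  x < k + \<theta> holds for some natural k exactly when the fractional part of norm x is below
  \<theta>. The choice of values on the interfaces affects only a null set.\<close>

definition stripe_profile :: "real \<Rightarrow> real \<Rightarrow> real \<Rightarrow> real ^ ('d::finite) \<Rightarrow> real" where
  "stripe_profile \<theta> a b x = (if frac (norm x) < \<theta> then a else b)"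

lemma stripe_profile_measurable [measurable]:
  "stripe_profile \<theta> a b \<in> borel_measurable borel"
  unfolding stripe_profile_def frac_def by measurable

section \<open>The weak formulation for the striped density\<close>

theorem proposition5p3:
  fixes \<mu> lam \<theta> a b :: real
    and p :: "real \<Rightarrow> real"
    and \<rho> :: "real \<times> (real ^ 'd) \<Rightarrow> real"
    and u :: "real \<times> (real ^ 'd) \<Rightarrow> real ^ 'd"
  assumes "\<mu> > 0" and "3 * lam + 2 * \<mu> > 0"
    and "0 < \<theta>" and "\<theta> < 1"
    and "0 < a / 2 ^ CARD('d)" and "a / 2 ^ CARD('d) < a"
    and "a < b / 2 ^ CARD('d)" and "b / 2 ^ CARD('d) < b"
    and "smooth_on {0<..} p"
    and "\<And>t. t \<in> {1..2} \<Longrightarrow> p (a / t ^ CARD('d)) = p (b / t ^ CARD('d))"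
    and "\<And>t y (k::nat). t \<in> {1..2} \<Longrightarrow> real k * t < norm y \<Longrightarrow> norm y < (real k + \<theta>) * t
           \<Longrightarrow> \<rho> (t, y) = a / t ^ CARD('d)"
    and "\<And>t y (k::nat). t \<in> {1..2} \<Longrightarrow> (real k + \<theta>) * t < norm y \<Longrightarrow> norm y < (real k + 1) * t
           \<Longrightarrow> \<rho> (t, y) = b / t ^ CARD('d)"
    and "\<And>t y. t \<in> {1..2} \<Longrightarrow> u (t, y) = (1 / t) *\<^sub>R y"
  shows "weak_solution_NS ({1<..<2} \<times> UNIV) \<mu> lam p \<rho> u"
proof -
  let ?\<Omega> = "{1<..<2::real} \<times> (UNIV :: (real ^ 'd) set)"
  define g :: "real ^ 'd \<Rightarrow> real" where "g = stripe_profile \<theta> a b"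
  have a: "0 < a" using assms(5) by (simp add: zero_less_divide_iff)
  then have b: "0 < b" using assms(7,8) by linarith
  have ab: "a \<le> b" using assms(7,8) by linarith
  have g_pos: "0 < g x" and g_le: "\<bar>g x\<bar> \<le> b" for x
    using a b ab by (auto simp: g_def stripe_profile_def)
  have g_meas [measurable]: "g \<in> borel_measurable borel"
    by (simp add: g_def)
  have \<rho>_AE: "AE z in lborel. z \<in> ?\<Omega> \<longrightarrow> \<rho> z = self_similar g z"
    using AE_norm_neq[where 'd = 'd, of real] AE_norm_neq[where 'd = 'd, of "\<lambda>k. real k + \<theta>"]
  proof (eventually_elim, intro impI)
    fix z assume n1: "\<forall>k. norm (snd z) \<noteq> real k * fst z"
      and n2: "\<forall>k. norm (snd z) \<noteq> (real k + \<theta>) * fst z" and "z \<in> ?\<Omega>"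
    then obtain t and y :: "real ^ 'd" where z: "z = (t, y)" and t: "1 < t" "t < 2" by auto
    \<comment> \<open>This is the shell index: k t \<le> norm y < (k + 1) t. The hypotheses on
      \<rho> require strict inequalities; \<open>n1\<close> and \<open>n2\<close> exclude equality
      at k t and at (k + \<theta>) t.\<close>
    define k where "k = nat \<lfloor>norm y / t\<rfloor>"
    have k: "real k = of_int \<lfloor>norm y / t\<rfloor>"
      using t by (simp add: k_def)
    have fr: "frac (norm y / t) = norm y / t - real k"
      by (simp add: frac_def k)
    have k1: "real k \<le> norm y / t" "norm y / t < real k + 1"
      unfolding k by linarith+
    then have k2: "real k * t \<le> norm y" "norm y < (real k + 1) * t"
      using t by (auto simp: field_simps)
    have "norm ((1 / t) *\<^sub>R y) = norm y / t" using t by simp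
    then have \<sigma>: "self_similar g z = (if norm y / t - real k < \<theta> then a else b) / t ^ CARD('d)"
      unfolding self_similar_def g_def stripe_profile_def z fst_conv snd_conv by (simp only: fr)
    show "\<rho> z = self_similar g z"
    proof (cases "norm y / t - real k < \<theta>")
      case True
      then have "norm y < (real k + \<theta>) * t" using t by (simp add: field_simps)
      then have "\<rho> (t, y) = a / t ^ CARD('d)"
        using assms(11)[of t k y] t k2(1) n1[rule_format, of k] z by auto
      then show ?thesis
        using \<sigma> True by (simp add: z)
    next
      case False
      then have "(real k + \<theta>) * t \<le> norm y" using t by (simp add: field_simps)
      then have "\<rho> (t, y) = b / t ^ CARD('d)"
        using assms(12)[of t k y] t k2(2) n2[rule_format, of k] z by auto
      then show ?thesis
        using \<sigma> False by (simp add: z)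
    qed
  qed
  have u: "u z $ i = snd z $ i / fst z" if "z \<in> ?\<Omega>" for z i
    using that assms(13)[of "fst z" "snd z"] by auto
  have \<rho>u_AE: "AE z in lborel. z \<in> ?\<Omega> \<longrightarrow> \<rho> z * u z $ i = self_similar (\<lambda>x. g x * x $ i) z" for i
    using \<rho>_AE by eventually_elim (auto simp: u self_similar_def)
  have \<rho>uu_AE: "AE z in lborel. z \<in> ?\<Omega> \<longrightarrow>
      \<rho> z * u z $ i * u z $ j = self_similar (\<lambda>x. g x * x $ i * x $ j) z" for i j
    using \<rho>_AE by eventually_elim (auto simp: u self_similar_def)
  have u_AE: "AE z in lborel. z \<in> ?\<Omega> \<longrightarrow> u z $ i = snd z $ i / fst z" for i
    by (simp add: u)
  \<comment> \<open>\<open>p\<close> is known to be continuous only on \<open>{0<..}\<close>, so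
    measurability of the composition is available on \<Omega>; the indicator extends it to the whole
    space.\<close>
  define P where "P z = indicator ?\<Omega> z *\<^sub>R p (a / fst z ^ CARD('d))" for z :: "'d spacetime"
  \<comment> \<open>Here the equality of the two pressures enters: both phases have the same
    pressure at time t, so it suffices to evaluate \<open>p\<close> at the phase with constant
    a.\<close>
  have p_AE: "AE z in lborel. z \<in> ?\<Omega> \<longrightarrow> p (\<rho> z) = P z"
    using \<rho>_AE
    by eventually_elim (auto simp: P_def self_similar_def g_def stripe_profile_def assms(10))
  have p_cont: "continuous_on ?\<Omega> (\<lambda>z. p (a / fst z ^ CARD('d)))"
  proof (rule continuous_on_compose2[of "{0<..}" p])
    show "continuous_on {0<..} p"
      using assms(9) unfolding smooth_on_def by (metis Ck_on.simps(1))
    show "continuous_on ?\<Omega> (\<lambda>z. a / fst z ^ CARD('d))"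
      by (intro continuous_intros) auto
  qed (use a in auto)
  have open\<Omega>: "open ?\<Omega>" by (intro open_Times) auto
  have P_meas: "P \<in> borel_measurable borel"
    unfolding P_def using p_cont open\<Omega> by (intro borel_measurable_continuous_on_indicator) auto
  have P_dom: "continuous_on ?\<Omega> (\<lambda>z. \<bar>p (a / fst z ^ CARD('d))\<bar>)"
    using p_cont by (intro continuous_intros)
  have P_le: "\<bar>P z\<bar> \<le> \<bar>p (a / fst z ^ CARD('d))\<bar>" for z
    by (simp add: P_def indicator_def)
  have [measurable]: "(\<lambda>x :: real ^ 'd. x $ i) \<in> borel_measurable borel" for i
    by (intro borel_measurable_continuous_onI continuous_intros)
  have u_meas: "(\<lambda>z::'d spacetime. snd z $ i / fst z) \<in> borel_measurable borel" for i
    unfolding borel_prod[symmetric] by measurable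
  have u_dom: "continuous_on ?\<Omega> (\<lambda>z. \<bar>snd z $ i / fst z\<bar>)" for i
    by (intro continuous_intros) auto
  have gi_meas: "(\<lambda>x. g x * x $ i) \<in> borel_measurable borel"
    and gij_meas: "(\<lambda>x. g x * x $ i * x $ j) \<in> borel_measurable borel" for i j
    by measurable
  \<comment> \<open>With 0 < g \<le> b these are continuous majorants of the density, momentum and
    momentum flux profiles. The last two profiles are unbounded, so constants would not do.\<close>
  have b_cont: "continuous_on UNIV (\<lambda>x. b)" "continuous_on UNIV (\<lambda>x. b * \<bar>x $ i\<bar>)"
    "continuous_on UNIV (\<lambda>x. b * \<bar>x $ i\<bar> * \<bar>x $ j\<bar>)" for i j :: 'd
    by (intro continuous_intros)+
  have gi_le: "\<bar>g x * x $ i\<bar> \<le> b * \<bar>x $ i\<bar>"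
    and gij_le: "\<bar>g x * x $ i * x $ j\<bar> \<le> b * \<bar>x $ i\<bar> * \<bar>x $ j\<bar>" for x i j
    using g_le[of x] by (auto simp: abs_mult intro!: mult_right_mono)
  \<comment> \<open>On each slice \<open>P\<close> is a constant factor, and the spatial derivative
    of \<phi> integrates to 0.\<close>
  have pressure: "distr_of ?\<Omega> (\<lambda>z. p (\<rho> z)) (dir_deriv (0, axis i 1) \<phi>) = 0"
    if \<phi>: "\<phi> \<in> test_functions ?\<Omega>" for i \<phi>
  proof -
    note \<psi> = test_function_dir_deriv[OF \<phi> axis_spatial_Basis[of i]]
    have "(\<integral>y. P (t, y) * dir_deriv (0, axis i 1) \<phi> (t, y) \<partial>lborel) = 0" for t
    proof -
      have "P (t, y) = indicator {1<..<2} t * p (a / t ^ CARD('d))" for y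
        by (simp add: P_def indicator_def)
      then show ?thesis by (simp add: integral_slice_spatial_deriv[OF \<phi>])
    qed
    then show ?thesis
      unfolding distr_of_AE_eq[OF p_AE P_meas \<psi>]
      by (intro integral_slices_eq_0 integrable_dominated_times_test_function[OF P_meas P_dom P_le \<psi>])
  qed
  \<comment> \<open>The divergence of the stress tests components u_k = y_k / t against second
    spatial derivatives of \<phi>. One integration by parts leaves a multiple of the slice integral
    of \<partial>_j \<phi>, which is 0.\<close>
  have viscous: "distr_of ?\<Omega> (\<lambda>z. u z $ k) (dir_deriv (0, axis i 1) (dir_deriv (0, axis j 1) \<phi>)) = 0"
    if \<phi>: "\<phi> \<in> test_functions ?\<Omega>" for i j k \<phi>
  proof -
    let ?\<psi> = "dir_deriv (0, axis j 1) \<phi>"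
    note \<psi> = test_function_dir_deriv[OF \<phi> axis_spatial_Basis[of j]]
    note \<psi>' = test_function_dir_deriv[OF \<psi> axis_spatial_Basis[of i]]
    have "(\<integral>y. y $ k / t * dir_deriv (0, axis i 1) ?\<psi> (t, y) \<partial>lborel) = 0" for t
      using integral_slice_coord_spatial_deriv[OF \<psi> integral_slice_spatial_deriv[OF \<phi>], of k i t]
      by simp
    then show ?thesis
      unfolding distr_of_AE_eq[OF u_AE u_meas \<psi>']
      by (intro integral_slices_eq_0 integrable_dominated_times_test_function[OF u_meas u_dom[of k] _ \<psi>']) auto
  qed
  have stress: "dx j (viscous_stress ?\<Omega> \<mu> lam u i j) \<phi> = 0"
    if "\<phi> \<in> test_functions ?\<Omega>" for i j \<phi>
    using viscous[OF that] by (cases "i = j") (simp_all add: distr_deriv_def viscous_stress_def)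
  have tB: "((1::real), (0 :: real ^ 'd)) \<in> Basis" by (simp add: Basis_prod_def)
  show ?thesis
    unfolding weak_solution_NS_def
  proof (intro conjI allI ballI)
    show "AE z in lebesgue. z \<in> ?\<Omega> \<longrightarrow> 0 < \<rho> z"
      using AE_completion[OF \<rho>_AE] by eventually_elim (auto simp: self_similar_def g_pos)
    show "\<rho> locally_integrable_on ?\<Omega>"
      by (rule locally_integrable_AE_eq[OF \<rho>_AE self_similar_measurable[OF g_meas]
            self_similar_dominated[OF b_cont(1) g_le]])
    show "(\<lambda>z. p (\<rho> z)) locally_integrable_on ?\<Omega>"
      by (rule locally_integrable_AE_eq[OF p_AE P_meas P_dom P_le])
    show "(\<lambda>z. u z $ i) locally_integrable_on ?\<Omega>" for i
      by (rule locally_integrable_AE_eq[OF u_AE u_meas u_dom[of i]]) simp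
    show "(\<lambda>z. \<rho> z * u z $ i) locally_integrable_on ?\<Omega>" for i
      by (rule locally_integrable_AE_eq[OF \<rho>u_AE self_similar_measurable[OF gi_meas]
            self_similar_dominated[OF b_cont(2) gi_le]])
    show "(\<lambda>z. \<rho> z * u z $ i * u z $ j) locally_integrable_on ?\<Omega>" for i j
      by (rule locally_integrable_AE_eq[OF \<rho>uu_AE self_similar_measurable[OF gij_meas]
            self_similar_dominated[OF b_cont(3) gij_le]])
  next
    fix \<phi> :: "'d spacetime \<Rightarrow> real" assume \<phi>: "\<phi> \<in> test_functions ?\<Omega>"
    note d = test_function_dir_deriv[OF \<phi> tB] test_function_dir_deriv[OF \<phi> axis_spatial_Basis]
    show "dt (distr_of ?\<Omega> \<rho>) \<phi> + (\<Sum>j\<in>UNIV. dx j (distr_of ?\<Omega> (\<lambda>z. \<rho> z * u z $ j)) \<phi>) = 0"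
      using self_similar_transport[OF g_meas b_cont(1) g_le \<phi>]
      by (simp add: distr_deriv_def sum_negf distr_of_AE_eq[OF \<rho>_AE self_similar_measurable[OF g_meas] d(1)]
            distr_of_AE_eq[OF \<rho>u_AE self_similar_measurable[OF gi_meas] d(2)])
    fix i
    show "dt (distr_of ?\<Omega> (\<lambda>z. \<rho> z * u z $ i)) \<phi>
        + (\<Sum>j\<in>UNIV. dx j (distr_of ?\<Omega> (\<lambda>z. \<rho> z * u z $ i * u z $ j)) \<phi>)
        + dx i (distr_of ?\<Omega> (\<lambda>z. p (\<rho> z))) \<phi>
        = (\<Sum>j\<in>UNIV. dx j (viscous_stress ?\<Omega> \<mu> lam u i j) \<phi>)"
      using self_similar_transport[OF gi_meas b_cont(2) gi_le \<phi>, of i]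
      unfolding stress[OF \<phi>]
      by (simp add: distr_deriv_def pressure \<phi> sum_negf
            distr_of_AE_eq[OF \<rho>u_AE self_similar_measurable[OF gi_meas] d(1)]
            distr_of_AE_eq[OF \<rho>uu_AE self_similar_measurable[OF gij_meas] d(2)])
  qed
qed

end
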